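(* Consider scheduling jobs with release times on $m\ge 1$ identical parallel machines with objective the total flow time, and let $B\ge1$ be the ratio of the maximum to the minimum job workload. There exists a work-conserving scheduling algorithm $\pi$ whose competitive ratio satisfies $\mathcal{CR}_\pi\ge B/2$.
   Context: Each job $i$ has workload $p_i>0$ and arrival time $r_i\ge0$. Each machine has unit speed, processes at most one job at a time, and each job is processed by at most one machine at a time and not before its arrival. In the preemptive model a running job may be interrupted and later continued on any machine; in the non-preemptive model a started job runs to completion; the statement is made for both models. The total flow time under $\pi$ on an instance $I$ is $F_\pi(I)=\sum_i (C_i^\pi-r_i)$, with $C_i^\pi$ the completion time of job $i$. A discipline is work-conserving if it never leaves a machine idle while there is at least one feasible job (released, unfinished, allowed to be processed under the constraints of the model) awaiting execution. The competitive ratio is $\mathcal{CR}_\pi=\sup_I F_\pi(I)/F_{\pi^*}(I)$, over all finite instances $I$ with $\max_i p_i/\min_i p_i=B$, where $\pi^*$ is an optimal offline schedule. *)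

theory Defs
  imports "HOL-Library.Extended_Real"
begin

datatype model = Preemptive | NonPreemptive

record job_instance =
  jobs :: "nat set"
  release :: "nat \<Rightarrow> real"
  workload :: "nat \<Rightarrow> real"

definition valid_instance :: "job_instance \<Rightarrow> bool" where
  "valid_instance I \<longleftrightarrow>
     finite (jobs I) \<and> jobs I \<noteq> {} \<and>
     (\<forall>j \<in> jobs I. 0 \<le> release I j \<and> 0 < workload I j)"

definition workload_ratio :: "job_instance \<Rightarrow> real" where
  "workload_ratio I = Max (workload I ` jobs I) / Min (workload I ` jobs I)"

text \<open>
  A schedule is a finite set of pieces. The piece \<open>Piece j k a b\<close> means that machine \<open>k\<close>
  (machines are numbered \<open>0, \<dots>, m - 1\<close>) processes job \<open>j\<close> without interruption, at unit speed,
  during the half-open interval \<open>{a..<b}\<close>. A preempted job has several pieces, possibly on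
  different machines.
\<close>

datatype piece = Piece (job: nat) (machine: nat) (start: real) (finish: real)

type_synonym schedule = "piece set"

definition interval :: "piece \<Rightarrow> real set" where
  "interval q = {start q..<finish q}"

definition feasible :: "model \<Rightarrow> nat \<Rightarrow> job_instance \<Rightarrow> schedule \<Rightarrow> bool" where
  "feasible M m I S \<longleftrightarrow>
     finite S \<and>
     (\<forall>q \<in> S. job q \<in> jobs I \<and> machine q < m \<and>
              release I (job q) \<le> start q \<and> start q < finish q) \<and>
     (\<forall>q \<in> S. \<forall>q' \<in> S. q \<noteq> q' \<and> (machine q = machine q' \<or> job q = job q') \<longrightarrow>
              interval q \<inter> interval q' = {}) \<and>
     (\<forall>j \<in> jobs I. (\<Sum>q | q \<in> S \<and> job q = j. finish q - start q) = workload I j) \<and>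
     (M = NonPreemptive \<longrightarrow> (\<forall>j \<in> jobs I. \<exists>!q. q \<in> S \<and> job q = j))"

definition completion :: "schedule \<Rightarrow> nat \<Rightarrow> real" where
  "completion S j = Max (finish ` {q \<in> S. job q = j})"

definition total_flow :: "job_instance \<Rightarrow> schedule \<Rightarrow> real" where
  "total_flow I S = (\<Sum>j \<in> jobs I. completion S j - release I j)"

definition processes :: "schedule \<Rightarrow> nat \<Rightarrow> real \<Rightarrow> nat \<Rightarrow> bool" where
  "processes S k t j \<longleftrightarrow> (\<exists>q \<in> S. machine q = k \<and> job q = j \<and> t \<in> interval q)"

text \<open>
  The same definition serves both models: when each job is a single piece, a job that is
  unfinished and not being processed has not been started yet, so it may be started at once.
\<close>

definition awaiting :: "job_instance \<Rightarrow> schedule \<Rightarrow> real \<Rightarrow> nat \<Rightarrow> bool" where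
  "awaiting I S t j \<longleftrightarrow>
     j \<in> jobs I \<and> release I j \<le> t \<and> t < completion S j \<and> (\<forall>k. \<not> processes S k t j)"

definition work_conserving_schedule :: "nat \<Rightarrow> job_instance \<Rightarrow> schedule \<Rightarrow> bool" where
  "work_conserving_schedule m I S \<longleftrightarrow>
     (\<forall>t. \<forall>k < m. (\<forall>j. \<not> processes S k t j) \<longrightarrow> (\<forall>j. \<not> awaiting I S t j))"

text \<open>
  Algorithms are online: what the machines do at time \<open>t\<close> depends only on the jobs released
  up to (and including) time \<open>t\<close>; the workload of a job is revealed at its release.
\<close>

definition known_jobs :: "job_instance \<Rightarrow> real \<Rightarrow> (nat \<times> real \<times> real) set" where
  "known_jobs I t = {(j, release I j, workload I j) | j. j \<in> jobs I \<and> release I j \<le> t}"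

definition scheduling_algorithm ::
    "model \<Rightarrow> nat \<Rightarrow> (job_instance \<Rightarrow> schedule) \<Rightarrow> bool" where
  "scheduling_algorithm M m \<pi> \<longleftrightarrow>
     (\<forall>I. valid_instance I \<longrightarrow> feasible M m I (\<pi> I)) \<and>
     (\<forall>I I' t. valid_instance I \<and> valid_instance I' \<and> known_jobs I t = known_jobs I' t \<longrightarrow>
        (\<forall>k j. processes (\<pi> I) k t j \<longleftrightarrow> processes (\<pi> I') k t j))"

definition work_conserving :: "nat \<Rightarrow> (job_instance \<Rightarrow> schedule) \<Rightarrow> bool" where
  "work_conserving m \<pi> \<longleftrightarrow>
     (\<forall>I. valid_instance I \<longrightarrow> work_conserving_schedule m I (\<pi> I))"

text \<open>
  For \<open>m \<ge> 1\<close> the infimum below ranges over a nonempty set bounded below by the (positive) sum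
  of the workloads, so the ratio in \<open>competitive_ratio\<close> has a positive denominator.
\<close>

definition optimal_flow :: "model \<Rightarrow> nat \<Rightarrow> job_instance \<Rightarrow> real" where
  "optimal_flow M m I = (INF S \<in> {S. feasible M m I S}. total_flow I S)"

definition competitive_ratio ::
    "model \<Rightarrow> nat \<Rightarrow> real \<Rightarrow> (job_instance \<Rightarrow> schedule) \<Rightarrow> ereal" where
  "competitive_ratio M m B \<pi> =
     (SUP I \<in> {I. valid_instance I \<and> workload_ratio I = B}.
        ereal (total_flow I (\<pi> I) / optimal_flow M m I))"

end

theory Submission
  imports Defs "HOL-Library.Product_Lexorder"
begin

text \<open>
  The algorithm is first-in-first-out list scheduling without preemption, with ties between
  release times broken by the job number. The bad instance has \<open>m\<close> jobs of workload \<open>B\<close> at time 0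
  and \<open>m\<close> unit jobs at each of the times \<open>0, \<dots>, N - 1\<close>. FIFO starts the long jobs first, so
  every unit job has flow time \<open>B + 1\<close>, whereas running the unit jobs on arrival and the long
  jobs from time \<open>N\<close> on gives total flow time \<open>m (2 N + B)\<close>. The ratio
  \<open>(B + N (B + 1)) / (2 N + B)\<close> tends to \<open>(B + 1) / 2\<close>, and it is at least \<open>B / 2\<close> as soon as
  \<open>2 N \<ge> B\<^sup>2\<close>. The optimum of the preemptive model is at most the non-preemptive one, so the same
  algorithm and instance serve both models.
\<close>

section \<open>FIFO list scheduling\<close>

text \<open>Taking the least index breaks ties so that each batch of the bad instance fills the
  machines \<open>0, ..., m - 1\<close> in order.\<close>

definition least_loaded :: "nat \<Rightarrow> (nat \<Rightarrow> real) \<Rightarrow> nat" where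
  "least_loaded m a = (LEAST k. k < m \<and> (\<forall>i<m. a k \<le> a i))"

text \<open>
  A queue entry is a triple of release time, job number and workload, so that the lexicographic
  order is the FIFO order; \<open>a k\<close> is the time from which machine \<open>k\<close> is free.
\<close>

fun place :: "nat \<Rightarrow> (nat \<Rightarrow> real) \<Rightarrow> real \<times> nat \<times> real \<Rightarrow> piece" where
  "place m a (r, j, p) =
     (let k = least_loaded m a; s = max r (a k) in Piece j k s (s + p))"

definition occupy :: "(nat \<Rightarrow> real) \<Rightarrow> piece \<Rightarrow> nat \<Rightarrow> real" where
  "occupy a q = a(machine q := finish q)"

fun fifo :: "nat \<Rightarrow> (nat \<Rightarrow> real) \<Rightarrow> (real \<times> nat \<times> real) list \<Rightarrow> schedule" where
  "fifo m a [] = {}"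
| "fifo m a (x # xs) = insert (place m a x) (fifo m (occupy a (place m a x)) xs)"

fun avail :: "nat \<Rightarrow> (nat \<Rightarrow> real) \<Rightarrow> (real \<times> nat \<times> real) list \<Rightarrow> nat \<Rightarrow> real" where
  "avail m a [] = a"
| "avail m a (x # xs) = avail m (occupy a (place m a x)) xs"

definition queue :: "job_instance \<Rightarrow> (real \<times> nat \<times> real) list" where
  "queue I = sorted_list_of_set ((\<lambda>j. (release I j, j, workload I j)) ` jobs I)"

definition fifo_algorithm :: "nat \<Rightarrow> job_instance \<Rightarrow> schedule" where
  "fifo_algorithm m I = fifo m (\<lambda>_. 0) (queue I)"

lemma least_loaded:
  assumes "m \<ge> 1"
  shows least_loaded_less: "least_loaded m a < m"
    and least_loaded_le: "i < m \<Longrightarrow> a (least_loaded m a) \<le> a i"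
proof -
  have "\<exists>k\<in>{..<m}. \<forall>i\<in>{..<m}. a k \<le> a i"
    using assms arg_min_if_finite(1)[of "{..<m}" a] arg_min_least[of "{..<m}" _ a]
    by (metis finite_lessThan lessThan_iff empty_iff less_le_trans zero_less_one)
  then have "\<exists>k. k < m \<and> (\<forall>i<m. a k \<le> a i)"
    by auto
  from LeastI_ex[OF this]
  show "least_loaded m a < m" "i < m \<Longrightarrow> a (least_loaded m a) \<le> a i"
    by (auto simp: least_loaded_def)
qed

lemma job_place [simp]: "job (place m a x) = fst (snd x)"
  and machine_place [simp]: "machine (place m a x) = least_loaded m a"
  and start_place [simp]: "start (place m a x) = max (fst x) (a (least_loaded m a))"
  and finish_place: "finish (place m a x) = start (place m a x) + snd (snd x)"
  by (cases x; simp add: Let_def)+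

declare place.simps [simp del]

lemma fifo_append: "fifo m a (xs @ ys) = fifo m a xs \<union> fifo m (avail m a xs) ys"
  by (induction xs arbitrary: a) auto

lemma avail_append: "avail m a (xs @ ys) = avail m (avail m a xs) ys"
  by (induction xs arbitrary: a) auto

lemma finite_fifo [simp]: "finite (fifo m a xs)"
  by (induction xs arbitrary: a) auto

lemma job_fifo: "job ` fifo m a xs = (fst \<circ> snd) ` set xs"
  by (induction xs arbitrary: a) auto

text \<open>Workloads are positive, so occupying a machine never lowers its entry of
  \<open>a\<close>; the lower bound on start times therefore survives the induction.\<close>

lemma fifo_pieceD:
  assumes "q \<in> fifo m a xs" "m \<ge> 1" "\<forall>x\<in>set xs. snd (snd x) > 0"
  shows "machine q < m \<and> a (machine q) \<le> start q \<and>
    (\<exists>r. (r, job q, finish q - start q) \<in> set xs \<and> r \<le> start q)"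
  using assms
proof (induction xs arbitrary: a)
  case (Cons x xs)
  obtain r j p where x: "x = (r, j, p)" by (cases x)
  show ?case
  proof (cases "q = place m a x")
    case True
    then show ?thesis
      using Cons.prems least_loaded_less[of m a] by (auto simp: x finish_place)
  next
    case False
    have "start (place m a x) \<le> finish (place m a x)"
      using Cons.prems by (auto simp: finish_place)
    then have "a k \<le> occupy a (place m a x) k" for k
      by (auto simp: occupy_def)
    moreover have "q \<in> fifo m (occupy a (place m a x)) xs"
      using Cons.prems False by auto
    ultimately show ?thesis
      using Cons.IH[of "occupy a (place m a x)"] Cons.prems order_trans
      by fastforce
  qed
qed auto

lemma fifo_start_ge_avail:
  assumes "q \<in> fifo m (occupy a (place m a x)) xs" "m \<ge> 1" "\<forall>y\<in>set xs. snd (snd y) > 0"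
    and "machine q = least_loaded m a"
  shows "finish (place m a x) \<le> start q"
  using fifo_pieceD[OF assms(1-3)] assms(4) by (simp add: occupy_def)

lemma fifo_machine_disjoint:
  assumes "q \<in> fifo m a xs" "q' \<in> fifo m a xs" "m \<ge> 1" "\<forall>x\<in>set xs. snd (snd x) > 0"
    and "machine q = machine q'" "q \<noteq> q'"
  shows "interval q \<inter> interval q' = {}"
  using assms
proof (induction xs arbitrary: a)
  case (Cons x xs)
  let ?q = "place m a x"
  have later: "interval ?q \<inter> interval p = {}"
    if "p \<in> fifo m (occupy a ?q) xs" "machine p = machine ?q" for p
    using fifo_start_ge_avail[OF that(1)] that(2) Cons.prems(3,4)
    by (auto simp: interval_def)
  consider "q = ?q" "q' \<in> fifo m (occupy a ?q) xs" | "q' = ?q" "q \<in> fifo m (occupy a ?q) xs"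
    | "q \<in> fifo m (occupy a ?q) xs" "q' \<in> fifo m (occupy a ?q) xs"
    using Cons.prems by auto
  then show ?case
  proof cases
    case 1 then show ?thesis using later[of q'] Cons.prems(5) by simp
  next
    case 2 then show ?thesis using later[of q] Cons.prems(5) by (simp add: Int_commute)
  next
    case 3 then show ?thesis using Cons by auto
  qed
qed auto

lemma inj_on_job_fifo:
  assumes "distinct (map (fst \<circ> snd) xs)"
  shows "inj_on job (fifo m a xs)"
  using assms
proof (induction xs arbitrary: a)
  case (Cons x xs)
  then show ?case
    using job_fifo[of m "occupy a (place m a x)" xs] by auto
qed auto

text \<open>Some piece moves the availability of machine \<open>k\<close> from at most
  \<open>t\<close> to beyond \<open>t\<close>. Its job is released by \<open>t\<close>, so it starts
  by \<open>t\<close> and covers \<open>t\<close>.\<close>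

lemma fifo_busy:
  assumes "\<forall>x\<in>set xs. fst x \<le> t" "a k \<le> t" "t < avail m a xs k"
  shows "\<exists>q\<in>fifo m a xs. machine q = k \<and> t \<in> interval q"
  using assms
proof (induction xs arbitrary: a)
  case (Cons x xs)
  let ?q = "place m a x"
  show ?case
  proof (cases "occupy a ?q k \<le> t")
    case True
    then show ?thesis using Cons by auto
  next
    case False
    then have "machine ?q = k" "t < finish ?q"
      using Cons.prems by (auto simp: occupy_def split: if_splits)
    moreover from this have "start ?q \<le> t"
      using Cons.prems by auto
    ultimately show ?thesis by (auto simp: interval_def)
  qed
qed auto

section \<open>Feasibility of the FIFO schedule\<close>

lemma queue_props:
  assumes "valid_instance I"
  shows set_queue: "set (queue I) = (\<lambda>j. (release I j, j, workload I j)) ` jobs I"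
    and sorted_queue: "sorted (queue I)"
    and distinct_queue: "distinct (queue I)"
    and distinct_jobs_queue: "distinct (map (fst \<circ> snd) (queue I))"
    and queue_workload_pos: "\<forall>x\<in>set (queue I). snd (snd x) > 0"
  using assms by (auto simp: queue_def valid_instance_def distinct_map inj_on_def)

lemma completion_eqI:
  assumes "q \<in> S" "job q = j" "inj_on job S"
  shows "completion S j = finish q"
proof -
  have "{q \<in> S. job q = j} = {q}"
    using assms by (auto dest: inj_onD)
  then show ?thesis by (simp add: completion_def)
qed

text \<open>A single piece per job meets the non-preemptive condition, so \<open>M\<close> stays
  arbitrary and both models are served at once.\<close>

lemma feasibleI:
  assumes "finite S" "inj_on job S" "job ` S = jobs I"
    and "\<And>q. q \<in> S \<Longrightarrow> machine q < m \<and> release I (job q) \<le> start q \<and>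
      start q < finish q \<and> finish q - start q = workload I (job q)"
    and "\<And>q q'. q \<in> S \<Longrightarrow> q' \<in> S \<Longrightarrow> q \<noteq> q' \<Longrightarrow> machine q = machine q' \<Longrightarrow>
      interval q \<inter> interval q' = {}"
  shows "feasible M m I S"
proof -
  have single: "\<exists>q. {q \<in> S. job q = j} = {q} \<and> q \<in> S \<and> job q = j" if "j \<in> jobs I" for j
    using that assms(2) unfolding assms(3)[symmetric] by (auto dest: inj_onD)
  have "(\<Sum>q | q \<in> S \<and> job q = j. finish q - start q) = workload I j" if "j \<in> jobs I" for j
    using single[OF that] assms(4) by auto
  moreover have "\<exists>!q. q \<in> S \<and> job q = j" if "j \<in> jobs I" for j
    using that assms(2) unfolding assms(3)[symmetric] by (auto dest: inj_onD)
  moreover have "interval q \<inter> interval q' = {}"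
    if "q \<in> S" "q' \<in> S" "q \<noteq> q' \<and> (machine q = machine q' \<or> job q = job q')" for q q'
    using that assms(2,5) by (auto dest: inj_onD)
  moreover have "job q \<in> jobs I" if "q \<in> S" for q
    using that assms(3) by auto
  ultimately show ?thesis
    unfolding feasible_def using assms(1,4) by (intro conjI ballI impI) simp_all
qed

lemma inj_on_job_fifo_algorithm:
  "valid_instance I \<Longrightarrow> inj_on job (fifo_algorithm m I)"
  by (simp add: fifo_algorithm_def inj_on_job_fifo distinct_jobs_queue)

lemma feasible_fifo:
  assumes "valid_instance I" "m \<ge> 1"
  shows "feasible M m I (fifo_algorithm m I)"
proof (rule feasibleI)
  show "inj_on job (fifo_algorithm m I)"
    by (rule inj_on_job_fifo_algorithm[OF assms(1)])
  show "job ` fifo_algorithm m I = jobs I"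
    using assms by (auto simp: fifo_algorithm_def job_fifo set_queue image_image)
next
  fix q assume "q \<in> fifo_algorithm m I"
  then have "machine q < m"
    "\<exists>r. (r, job q, finish q - start q) \<in> set (queue I) \<and> r \<le> start q"
    using fifo_pieceD[of q m "\<lambda>_. 0" "queue I"] assms queue_workload_pos[OF assms(1)]
    by (auto simp: fifo_algorithm_def)
  then show "machine q < m \<and> release I (job q) \<le> start q \<and>
      start q < finish q \<and> finish q - start q = workload I (job q)"
    using assms by (auto simp: set_queue valid_instance_def)
qed (use assms fifo_machine_disjoint queue_workload_pos in \<open>auto simp: fifo_algorithm_def\<close>)

text \<open>A job waiting at \<open>t\<close> found even the least loaded machine taken until after
  \<open>t\<close>, hence every machine. The jobs ahead of it in the queue are all released by
  \<open>t\<close>, so by \<open>fifo_busy\<close> they keep each machine busy at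
  \<open>t\<close>.\<close>

lemma work_conserving_fifo:
  assumes "m \<ge> 1"
  shows "work_conserving m (fifo_algorithm m)"
  unfolding work_conserving_def work_conserving_schedule_def
proof (intro allI impI notI)
  fix I t k j
  assume I: "valid_instance I" and "k < m"
    and idle: "\<forall>j. \<not> processes (fifo_algorithm m I) k t j"
    and await: "awaiting I (fifo_algorithm m I) t j"
  let ?x = "(release I j, j, workload I j)"
  have j: "j \<in> jobs I" "release I j \<le> t" "t < completion (fifo_algorithm m I) j"
    using await by (auto simp: awaiting_def)
  \<comment> \<open>\<open>fifo_busy\<close> asks that the initial availability, which is 0, be at
    most \<open>t\<close>.\<close>
  then have t: "0 \<le> t"
    using I by (force simp: valid_instance_def)
  have "?x \<in> set (queue I)"
    using j I by (auto simp: set_queue)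
  then obtain xs ys where split: "queue I = xs @ ?x # ys"
    by (auto simp: in_set_conv_decomp)
  define a where "a = avail m (\<lambda>_. 0) xs"
  have fifo: "fifo_algorithm m I =
    fifo m (\<lambda>_. 0) xs \<union> insert (place m a ?x) (fifo m (occupy a (place m a ?x)) ys)"
    by (simp add: fifo_algorithm_def split fifo_append a_def)
  have "place m a ?x \<in> fifo_algorithm m I"
    by (simp add: fifo)
  moreover have "completion (fifo_algorithm m I) j = finish (place m a ?x)"
    using calculation I by (intro completion_eqI inj_on_job_fifo_algorithm) auto
  ultimately have "t < start (place m a ?x)"
    using await j by (force simp: awaiting_def processes_def interval_def)
  \<comment> \<open>The job is released by \<open>t\<close>, so the maximum in
    \<open>start_place\<close> comes from the machine.\<close>
  then have "t < a (least_loaded m a)"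
    using j by simp
  also have "\<dots> \<le> a k"
    using assms \<open>k < m\<close> by (rule least_loaded_le)
  finally have "t < avail m (\<lambda>_. 0) xs k"
    by (simp add: a_def)
  moreover have "\<forall>y\<in>set xs. fst y \<le> t"
    using sorted_queue[OF I] j(2) by (auto simp: split sorted_append less_eq_prod_def)
  ultimately obtain q where "q \<in> fifo m (\<lambda>_. 0) xs" "machine q = k" "t \<in> interval q"
    using fifo_busy[of xs t "\<lambda>_. 0" k m] t by auto
  then show False
    using idle by (auto simp: processes_def fifo)
qed

section \<open>FIFO as an online algorithm\<close>

lemma queue_split:
  assumes "valid_instance I"
  shows "queue I = filter (\<lambda>x. fst x \<le> t) (queue I) @ filter (\<lambda>x. \<not> fst x \<le> t) (queue I)"
proof (rule sorted_distinct_set_unique)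
  \<comment> \<open>The release time is the leading component, so the jobs released by
    \<open>t\<close> form a prefix.\<close>
  show "sorted (filter (\<lambda>x. fst x \<le> t) (queue I) @ filter (\<lambda>x. \<not> fst x \<le> t) (queue I))"
    using sorted_queue[OF assms]
    by (auto simp: sorted_append sorted_wrt_filter less_eq_prod_def)
qed (use assms in \<open>auto simp: sorted_queue distinct_queue\<close>)

text \<open>Expresses the prefix through \<open>known_jobs I t\<close> alone, as the online
  condition demands.\<close>

lemma filter_queue:
  assumes "valid_instance I"
  shows "filter (\<lambda>x. fst x \<le> t) (queue I) =
    sorted_list_of_set ((\<lambda>(j, r, p). (r, j, p)) ` known_jobs I t)"
proof (rule sorted_distinct_set_unique)
  have eq: "(\<lambda>(j, r, p). (r, j, p)) ` known_jobs I t = set (filter (\<lambda>x. fst x \<le> t) (queue I))"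
    using assms by (force simp: set_queue known_jobs_def)
  show "set (filter (\<lambda>x. fst x \<le> t) (queue I)) =
    set (sorted_list_of_set ((\<lambda>(j, r, p). (r, j, p)) ` known_jobs I t))"
    by (simp only: eq set_sorted_list_of_set finite_set)
qed (use assms in \<open>auto simp: sorted_wrt_filter sorted_queue distinct_queue\<close>)

text \<open>Jobs released after \<open>t\<close> stand behind the prefix and start after
  \<open>t\<close>, so they affect neither its placement nor what runs at \<open>t\<close>.\<close>

lemma processes_fifo_algorithm:
  assumes "valid_instance I" "m \<ge> 1"
  shows "processes (fifo_algorithm m I) k t j \<longleftrightarrow>
    processes (fifo m (\<lambda>_. 0) (filter (\<lambda>x. fst x \<le> t) (queue I))) k t j"
proof -
  let ?xs = "filter (\<lambda>x. fst x \<le> t) (queue I)" and ?ys = "filter (\<lambda>x. \<not> fst x \<le> t) (queue I)"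
  have "fifo_algorithm m I = fifo m (\<lambda>_. 0) ?xs \<union> fifo m (avail m (\<lambda>_. 0) ?xs) ?ys"
    unfolding fifo_algorithm_def fifo_append[symmetric] using queue_split[OF assms(1)] by simp
  moreover have "t \<notin> interval q" if "q \<in> fifo m (avail m (\<lambda>_. 0) ?xs) ?ys" for q
    using fifo_pieceD[OF that assms(2)] queue_workload_pos[OF assms(1)]
    by (auto simp: interval_def)
  ultimately show ?thesis
    by (auto simp: processes_def)
qed

lemma scheduling_algorithm_fifo:
  "m \<ge> 1 \<Longrightarrow> scheduling_algorithm M m (fifo_algorithm m)"
  by (auto simp: scheduling_algorithm_def feasible_fifo processes_fifo_algorithm filter_queue)

section \<open>The optimum is positive\<close>

text \<open>Induction on the number of pieces, removing the one that starts last: by disjointness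
  the others finish before it starts, and its start replaces \<open>c\<close>.\<close>

lemma sum_disjoint_pieces_le:
  assumes "finite S" "\<And>q. q \<in> S \<Longrightarrow> b \<le> start q \<and> start q < finish q \<and> finish q \<le> c"
    and "\<And>q q'. q \<in> S \<Longrightarrow> q' \<in> S \<Longrightarrow> q \<noteq> q' \<Longrightarrow> interval q \<inter> interval q' = {}"
    and "b \<le> c"
  shows "(\<Sum>q\<in>S. finish q - start q) \<le> c - b"
  using assms
proof (induction "card S" arbitrary: S c)
  case 0
  then show ?case by simp
next
  case (Suc n)
  then have "S \<noteq> {}" by auto
  with Suc.prems(1) have "Max (start ` S) \<in> start ` S"
    by (intro Max_in) auto
  then obtain q where "q \<in> S" "start q = Max (start ` S)"
    by auto
  with Suc.prems(1) have q: "q \<in> S" "\<And>q'. q' \<in> S \<Longrightarrow> start q' \<le> start q"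
    by auto
  have before: "finish q' \<le> start q" if "q' \<in> S - {q}" for q'
  proof (rule ccontr)
    assume "\<not> finish q' \<le> start q"
    then have "start q \<in> interval q \<inter> interval q'"
      using that q Suc.prems(2) by (auto simp: interval_def)
    then show False using that q Suc.prems(3)[of q q'] by auto
  qed
  have "(\<Sum>q\<in>S - {q}. finish q - start q) \<le> start q - b"
  proof (rule Suc.hyps(1))
    show "n = card (S - {q})"
      using Suc.hyps(2) q Suc.prems(1) by simp
  qed (use Suc.prems q before in auto)
  moreover have "finish q \<le> c"
    using q Suc.prems by auto
  ultimately show ?case
    using Suc.prems(1) q by (simp add: sum.remove)
qed

lemma workload_le_flow:
  assumes "feasible M m I S" "valid_instance I" "j \<in> jobs I"
  shows "workload I j \<le> completion S j - release I j"
proof -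
  let ?T = "{q \<in> S. job q = j}"
  have S: "finite S" "\<And>q. q \<in> S \<Longrightarrow> release I (job q) \<le> start q \<and> start q < finish q"
    "\<And>q q'. q \<in> S \<Longrightarrow> q' \<in> S \<Longrightarrow> q \<noteq> q' \<Longrightarrow> job q = job q' \<Longrightarrow> interval q \<inter> interval q' = {}"
    and sum: "(\<Sum>q\<in>?T. finish q - start q) = workload I j"
    using assms(1,3) by (auto simp: feasible_def)
  have le: "finish q \<le> completion S j" if "q \<in> ?T" for q
    using that S(1) by (auto simp: completion_def)
  have "workload I j > 0"
    \<comment> \<open>Positivity rules out an empty set of pieces, for which the \<open>Max\<close>
      in \<open>completion\<close> would be unspecified.\<close>
    using assms by (auto simp: valid_instance_def)
  with sum have "?T \<noteq> {}"
    by (metis sum.empty less_irrefl)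
  then obtain q where "q \<in> ?T" by blast
  then have "release I j \<le> completion S j"
    using S(2)[of q] le[of q] by auto
  then show ?thesis
    using sum_disjoint_pieces_le[of ?T "release I j" "completion S j"] S le sum by auto
qed

lemma sum_workload_le_total_flow:
  assumes "feasible M m I S" "valid_instance I"
  shows "(\<Sum>j\<in>jobs I. workload I j) \<le> total_flow I S"
  unfolding total_flow_def using workload_le_flow[OF assms] by (rule sum_mono)

text \<open>An infimum of reals is a lower bound only for sets bounded below; the sum of the
  workloads supplies the bound.\<close>

lemma optimal_flow_le:
  assumes "feasible M m I S" "valid_instance I"
  shows "optimal_flow M m I \<le> total_flow I S"
  unfolding optimal_flow_def
  using assms sum_workload_le_total_flow[OF _ assms(2)]
  by (intro cINF_lower) (auto intro!: bdd_belowI2)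

lemma optimal_flow_pos:
  assumes "feasible M m I S" "valid_instance I"
  shows "0 < optimal_flow M m I"
proof -
  have "0 < (\<Sum>j\<in>jobs I. workload I j)"
    using assms(2) by (intro sum_pos) (auto simp: valid_instance_def)
  also have "\<dots> \<le> optimal_flow M m I"
    unfolding optimal_flow_def
    using assms(1) sum_workload_le_total_flow[OF _ assms(2)] by (intro cINF_greatest) auto
  finally show ?thesis .
qed

section \<open>The bad instance\<close>

text \<open>
  Job \<open>n\<close> belongs to batch \<open>n div m\<close>. Batch 0 consists of the long jobs and batch \<open>c + 1\<close> of the
  unit jobs released at time \<open>c\<close>; the truncated subtraction in \<open>batch_release\<close> gives batch 0
  release time 0.
\<close>

definition batch_release :: "nat \<Rightarrow> real" where
  "batch_release c = real (c - 1)"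

definition batch_workload :: "real \<Rightarrow> nat \<Rightarrow> real" where
  "batch_workload B c = (if c = 0 then B else 1)"

definition bad_instance :: "nat \<Rightarrow> real \<Rightarrow> nat \<Rightarrow> job_instance" where
  "bad_instance m B N =
     \<lparr>jobs = {..<m * Suc N}, release = (\<lambda>n. batch_release (n div m)),
      workload = (\<lambda>n. batch_workload B (n div m))\<rparr>"

text \<open>FIFO and the comparison schedule both have this shape and differ only in the batch start
  times \<open>s\<close>.\<close>

definition batch_schedule :: "nat \<Rightarrow> real \<Rightarrow> nat \<Rightarrow> (nat \<Rightarrow> real) \<Rightarrow> schedule" where
  "batch_schedule m B n s =
     (\<lambda>i. Piece i (i mod m) (s (i div m)) (s (i div m) + batch_workload B (i div m))) ` {..<n}"

text \<open>For \<open>c > 0\<close>, batch \<open>c\<close> waits for the long batch and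
  \<open>c - 1\<close> unit batches.\<close>

definition fifo_start :: "real \<Rightarrow> nat \<Rightarrow> real" where
  "fifo_start B c = (if c = 0 then 0 else B + real c - 1)"

definition good_start :: "nat \<Rightarrow> nat \<Rightarrow> real" where
  "good_start N c = (if c = 0 then real N else real c - 1)"

lemma sum_div_nat:
  fixes f :: "nat \<Rightarrow> real"
  assumes "m \<ge> 1"
  shows "(\<Sum>i<m * n. f (i div m)) = real m * (\<Sum>c<n. f c)"
proof -
  have "(\<Sum>i = c * m..<c * m + m. f (i div m)) = real m * f c" for c
  proof -
    have "i div m = c" if "i \<in> {c * m..<c * m + m}" for i
      using that by (auto intro!: div_nat_eqI simp: mult.commute)
    then show ?thesis by simp
  qed
  then show ?thesis
    using sum.nat_group[of "\<lambda>i. f (i div m)" m n]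
    by (simp add: mult.commute sum_distrib_left)
qed

lemma inj_on_job_batch_schedule: "inj_on job (batch_schedule m B n s)"
  by (auto simp: batch_schedule_def inj_on_def)

lemma total_flow_batch_schedule:
  assumes "m \<ge> 1"
  shows "total_flow (bad_instance m B N) (batch_schedule m B (m * Suc N) s) =
    real m * (\<Sum>c<Suc N. s c + batch_workload B c - batch_release c)"
proof -
  have "completion (batch_schedule m B n s) i = s (i div m) + batch_workload B (i div m)"
    if "i < n" for i n
  proof -
    let ?q = "Piece i (i mod m) (s (i div m)) (s (i div m) + batch_workload B (i div m))"
    have "?q \<in> batch_schedule m B n s"
      using that by (auto simp: batch_schedule_def)
    then show ?thesis
      using completion_eqI[of ?q _ i] by (simp add: inj_on_job_batch_schedule)
  qed
  then have "total_flow (bad_instance m B N) (batch_schedule m B (m * Suc N) s) =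
    (\<Sum>i<m * Suc N. s (i div m) + batch_workload B (i div m) - batch_release (i div m))"
    unfolding total_flow_def by (intro sum.cong) (auto simp: bad_instance_def)
  then show ?thesis
    by (simp only: sum_div_nat[OF assms, of "\<lambda>c. s c + batch_workload B c - batch_release c"])
qed

text \<open>Per machine, the long job contributes \<open>B\<close> and each unit job
  \<open>(B + c - 1) + 1 - (c - 1) = B + 1\<close>.\<close>

lemma total_flow_fifo_start:
  assumes "m \<ge> 1"
  shows "total_flow (bad_instance m B N) (batch_schedule m B (m * Suc N) (fifo_start B)) =
    real m * (B + real N * (B + 1))"
  unfolding total_flow_batch_schedule[OF assms] sum.lessThan_Suc_shift
  by (simp add: fifo_start_def batch_workload_def batch_release_def)

text \<open>Per machine, the \<open>N\<close> unit jobs contribute 1 each and the long job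
  \<open>N + B\<close>.\<close>

lemma total_flow_good_start:
  assumes "m \<ge> 1"
  shows "total_flow (bad_instance m B N) (batch_schedule m B (m * Suc N) (good_start N)) =
    real m * (2 * real N + B)"
  unfolding total_flow_batch_schedule[OF assms] sum.lessThan_Suc_shift
  by (simp add: good_start_def batch_workload_def batch_release_def)

lemma valid_bad_instance:
  "m \<ge> 1 \<Longrightarrow> B \<ge> 1 \<Longrightarrow> valid_instance (bad_instance m B N)"
  by (auto simp: valid_instance_def bad_instance_def batch_release_def batch_workload_def
      lessThan_empty_iff)

lemma workload_ratio_bad_instance:
  assumes "m \<ge> 1" "B \<ge> 1" "N \<ge> 1"
  shows "workload_ratio (bad_instance m B N) = B"
proof -
  \<comment> \<open>Job \<open>0\<close> is long and job \<open>m\<close> is the first unit job,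
    present because \<open>N \<ge> 1\<close>.\<close>
  have "0 < m * Suc N" "m < m * Suc N"
    using assms by auto
  then have "0 \<in> jobs (bad_instance m B N)" "m \<in> jobs (bad_instance m B N)"
    by (simp_all add: bad_instance_def)
  moreover have "workload (bad_instance m B N) 0 = B" "workload (bad_instance m B N) m = 1"
    using assms by (simp_all add: bad_instance_def batch_workload_def)
  moreover have "workload (bad_instance m B N) i \<in> {B, 1}" for i
    by (simp add: bad_instance_def batch_workload_def)
  ultimately have "workload (bad_instance m B N) ` jobs (bad_instance m B N) = {B, 1}"
    by (auto simp: image_iff) metis+
  then show ?thesis
    using assms by (simp add: workload_ratio_def)
qed

lemma feasible_good_start:
  assumes "m \<ge> 1" "B \<ge> 1"
  shows "feasible M m (bad_instance m B N) (batch_schedule m B (m * Suc N) (good_start N))"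
proof (rule feasibleI)
  let ?S = "batch_schedule m B (m * Suc N) (good_start N)"
  let ?J = "\<lambda>c. {good_start N c..<good_start N c + batch_workload B c}"
  \<comment> \<open>Unit batch \<open>c\<close> fills the slot from \<open>c - 1\<close> to
    \<open>c \<le> N\<close>; the long batch starts at \<open>N\<close>.\<close>
  have disj: "?J c \<inter> ?J d = {}" if "c < d" "d \<le> N" for c d
  proof -
    have "real c + 1 \<le> real d" "real d \<le> real N"
      using that by linarith+
    then show ?thesis
      by (auto simp: good_start_def batch_workload_def)
  qed
  have le: "i div m \<le> N" if "i < m * Suc N" for i
    using that less_mult_imp_div_less[of i "Suc N" m] by (simp add: mult.commute)
  show "interval q \<inter> interval q' = {}"
    if S: "q \<in> ?S" "q' \<in> ?S" "q \<noteq> q'" "machine q = machine q'" for q q'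
  proof -
    obtain i where i: "i < m * Suc N"
        "q = Piece i (i mod m) (good_start N (i div m))
          (good_start N (i div m) + batch_workload B (i div m))"
      using S(1) unfolding batch_schedule_def by blast
    obtain i' where i': "i' < m * Suc N"
        "q' = Piece i' (i' mod m) (good_start N (i' div m))
          (good_start N (i' div m) + batch_workload B (i' div m))"
      using S(2) unfolding batch_schedule_def by blast
    have J: "interval q = ?J (i div m)" "interval q' = ?J (i' div m)"
      by (simp_all add: interval_def i i')
    have "i \<noteq> i'" "i mod m = i' mod m"
      using S(3,4) i i' by auto
    then have "i div m \<noteq> i' div m"
      by (metis div_mult_mod_eq)
    then show ?thesis
      unfolding J using disj[of "i div m" "i' div m"] disj[of "i' div m" "i div m"]
        le[OF i(1)] le[OF i'(1)]
      by (metis Int_commute linorder_neqE_nat)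
  qed
  show "job ` ?S = jobs (bad_instance m B N)"
    by (simp add: batch_schedule_def bad_instance_def image_image)
qed (use assms in \<open>auto simp: batch_schedule_def inj_on_job_batch_schedule bad_instance_def
      good_start_def batch_release_def batch_workload_def inj_on_def\<close>)

section \<open>FIFO on the bad instance\<close>

lemma queue_bad_instance:
  assumes "m \<ge> 1" "B \<ge> 1"
  shows "queue (bad_instance m B N) =
    map (\<lambda>i. (batch_release (i div m), i, batch_workload B (i div m))) [0..<m * Suc N]"
    (is "_ = map ?f _")
proof (rule sorted_distinct_set_unique)
  note I = valid_bad_instance[OF assms]
  show "sorted (queue (bad_instance m B N))" "distinct (queue (bad_instance m B N))"
    using I by (rule sorted_queue distinct_queue)+
  show "set (queue (bad_instance m B N)) = set (map ?f [0..<m * Suc N])"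
    unfolding set_queue[OF I] by (simp add: bad_instance_def atLeast0LessThan)
  have "batch_release (i div m) \<le> batch_release (j div m)" if "i \<le> j" for i j
    unfolding batch_release_def using div_le_mono[OF that, of m] by simp
  \<comment> \<open>At time 0 the long jobs tie with the first unit jobs; their smaller numbers put
    them first.\<close>
  then have "?f i \<le> ?f j" if "i < j" for i j
    using that by (auto simp: less_eq_prod_def order_le_less)
  then show "sorted (map ?f [0..<m * Suc N])"
    by (auto simp: sorted_iff_nth_mono_less)
  show "distinct (map ?f [0..<m * Suc N])"
    by (auto simp: distinct_map inj_on_def)
qed

text \<open>Induction on the number of jobs placed. \<open>fifo_start B c\<close> is both the start
  of batch \<open>c\<close> and the time from which a machine that has served batches
  \<open>0, ..., c - 1\<close> is free; the machines below \<open>n mod m\<close> are one batch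
  ahead.\<close>

lemma fifo_batches:
  assumes "m \<ge> 1" "B \<ge> 1"
  defines "f \<equiv> \<lambda>i. (batch_release (i div m), i, batch_workload B (i div m))"
  shows "fifo m (\<lambda>_. 0) (map f [0..<n]) = batch_schedule m B n (fifo_start B) \<and>
    (\<forall>k<m. avail m (\<lambda>_. 0) (map f [0..<n]) k =
       fifo_start B (if k < n mod m then Suc (n div m) else n div m))"
proof (induction n)
  case 0
  then show ?case by (simp add: batch_schedule_def fifo_start_def)
next
  case (Suc n)
  define a where "a = avail m (\<lambda>_. 0) (map f [0..<n])"
  let ?s = "fifo_start B" and ?c = "n div m"
  have a: "a k = ?s (if k < n mod m then Suc ?c else ?c)" if "k < m" for k
    using Suc that by (simp add: a_def)
  have mod: "n mod m < m" using assms by simp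
  have less: "?s ?c < ?s (Suc ?c)"
    using assms by (auto simp: fifo_start_def)
  \<comment> \<open>Machines one batch ahead are free strictly later, so the first of the others is
    chosen.\<close>
  have ll: "least_loaded m a = n mod m"
    unfolding least_loaded_def
  proof (rule Least_equality)
    show "n mod m < m \<and> (\<forall>i<m. a (n mod m) \<le> a i)"
      using mod less by (auto simp: a)
    show "n mod m \<le> k" if "k < m \<and> (\<forall>i<m. a k \<le> a i)" for k
    proof (rule ccontr)
      assume "\<not> n mod m \<le> k"
      moreover have "a k \<le> a (n mod m)" using that mod by blast
      ultimately show False using that mod less by (simp add: a)
    qed
  qed
  have "batch_release ?c \<le> ?s ?c" and step: "?s ?c + batch_workload B ?c = ?s (Suc ?c)"
    using assms by (auto simp: batch_release_def fifo_start_def batch_workload_def)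
  then have place: "place m a (f n) = Piece n (n mod m) (?s ?c) (?s ?c + batch_workload B ?c)"
    using mod by (simp add: f_def place.simps Let_def ll a max_def)
  have "fifo m (\<lambda>_. 0) (map f [0..<Suc n]) = batch_schedule m B (Suc n) ?s"
    using Suc by (simp add: fifo_append flip: a_def)
      (simp add: place batch_schedule_def lessThan_Suc)
  \<comment> \<open>When \<open>Suc n mod m\<close> wraps to 0, the batch is complete and all
    machines are level again.\<close>
  moreover have "avail m (\<lambda>_. 0) (map f [0..<Suc n]) k =
      ?s (if k < Suc n mod m then Suc (Suc n div m) else Suc n div m)" if "k < m" for k
    using that mod
    by (simp add: avail_append flip: a_def)
      (auto simp: place occupy_def step a mod_Suc div_Suc less_Suc_eq)
  ultimately show ?case by blast
qed

lemma fifo_bad_instance: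
  "m \<ge> 1 \<Longrightarrow> B \<ge> 1 \<Longrightarrow>
    fifo_algorithm m (bad_instance m B N) = batch_schedule m B (m * Suc N) (fifo_start B)"
  unfolding fifo_algorithm_def queue_bad_instance by (rule conjunct1[OF fifo_batches])

section \<open>Comparison of the two flow times\<close>

lemma competitive_ratio_fifo:
  assumes "m \<ge> 1" "B \<ge> 1"
  shows "ereal (B / 2) \<le> competitive_ratio M m B (fifo_algorithm m)"
proof -
  obtain N where N: "B\<^sup>2 / 2 \<le> real N"
    using real_arch_simple by blast
  moreover have "0 < B\<^sup>2 / 2"
    using assms by simp
  ultimately have "N \<ge> 1"
    by (cases N) auto
  let ?I = "bad_instance m B N"
  let ?opt = "optimal_flow M m ?I"
  note good = feasible_good_start[OF assms, of M N] valid_bad_instance[OF assms, of N]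
  have "?opt \<le> real m * (2 * real N + B)"
    using optimal_flow_le[OF good] total_flow_good_start[OF assms(1), of B N] by simp
  then have "B / 2 * ?opt \<le> B / 2 * (real m * (2 * real N + B))"
    using assms by (intro mult_left_mono) auto
  also have "\<dots> = real m * (B * real N + B\<^sup>2 / 2)"
    by (simp add: field_simps power2_eq_square)
  \<comment> \<open>After cancelling \<open>B * N\<close> this is
    \<open>B^2 / 2 \<le> B + N\<close>, which the choice of \<open>N\<close> ensures.\<close>
  also have "\<dots> \<le> real m * (B + real N * (B + 1))"
    using N assms by (intro mult_left_mono) (auto simp: algebra_simps)
  also have "\<dots> = total_flow ?I (fifo_algorithm m ?I)"
    using assms by (simp add: fifo_bad_instance total_flow_fifo_start del: mult_Suc_right)
  finally have "B / 2 \<le> total_flow ?I (fifo_algorithm m ?I) / ?opt"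
    using optimal_flow_pos[OF good] by (simp only: pos_le_divide_eq)
  moreover have "?I \<in> {I. valid_instance I \<and> workload_ratio I = B}"
    using good workload_ratio_bad_instance[OF assms \<open>N \<ge> 1\<close>] by simp
  ultimately show ?thesis
    unfolding competitive_ratio_def by (intro SUP_upper2) auto
qed

theorem proposition9:
  fixes M :: model and m :: nat and B :: real
  assumes "m \<ge> 1" and "B \<ge> 1"
  shows "\<exists>\<pi>. scheduling_algorithm M m \<pi> \<and> work_conserving m \<pi> \<and>
             competitive_ratio M m B \<pi> \<ge> ereal (B / 2)"
  using assms scheduling_algorithm_fifo work_conserving_fifo competitive_ratio_fifo by blast

end
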